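(* Let $K_n+I$ denote the graph obtained by adding a self-loop to each vertex of the complete graph $K_n$, where $n\ge 1$. Then for $n\ge 2$, there is pretty good state transfer in $(K_n+I)\circ\overline{K}_2$ between the vertices $(v,1)$ and $(v,2)$, for each vertex $v$ of $K_n$, where the vertices of $\overline{K}_2$ are denoted by $1$ and $2$.
   Context: $\overline{K}_2$ is the edgeless graph on the two vertices $1,2$. The adjacency matrix of $K_n+I$ is the $n\times n$ all-ones matrix $J_n$. For a graph $G$ on $n$ vertices (possibly with loops) and a graph $H$ on $m$ vertices, the corona $G\circ H$ has vertex set $V(G)\times(\{0\}\cup V(H))$ (where $0\notin V(H)$): the vertices $(v,0)$ carry a copy of $G$ (including its loops), each set $\{v\}\times V(H)$ carries a copy of $H$, and $(v,0)$ is joined to every vertex of $\{v\}\times V(H)$. Its adjacency matrix is $A(G\circ H)=A(G)\otimes e_0e_0^T+I_n\otimes\begin{pmatrix}0&j_m^T\\ j_m&A(H)\end{pmatrix}$, where $j_m$ is the all-ones vector and $e_0$ is the standard basis vector indexed by $0$. A graph $X$ with adjacency matrix $A(X)$ has pretty good state transfer between vertices $a,b$ if for every $\epsilon>0$ there are a time $\tau$ and a complex number $\gamma$ with $|\gamma|=1$ such that $\|e^{-\mathrm{i}\tau A(X)}e_a-\gamma e_b\|<\epsilon$, where $e_a$ is the standard basis vector indexed by $a$. *)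

theory Defs
  imports "HOL-Analysis.Analysis"
begin

text \<open>A graph on the finite vertex type \<open>'v\<close>, possibly with loops but without multiple edges,
  is given by its (symmetric) adjacency relation.\<close>

type_synonym 'v graph = "'v \<Rightarrow> 'v \<Rightarrow> bool"

definition complete_graph :: "'v graph" where
  "complete_graph u v \<longleftrightarrow> u \<noteq> v"

definition edgeless_graph :: "'v graph" where
  "edgeless_graph u v \<longleftrightarrow> False"

definition add_loops :: "'v graph \<Rightarrow> 'v graph" where
  "add_loops G u v \<longleftrightarrow> G u v \<or> u = v"

text \<open>The corona has vertex set \<open>V(G) \<times> ({0} \<union> V(H))\<close>; the extra element \<open>0 \<notin> V(H)\<close> is \<open>None\<close>
  and a vertex \<open>h\<close> of \<open>H\<close> is \<open>Some h\<close>.\<close>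

fun corona :: "'a graph \<Rightarrow> 'b graph \<Rightarrow> ('a \<times> 'b option) graph" where
  "corona G H (u, None) (v, None) \<longleftrightarrow> G u v"
| "corona G H (u, None) (v, Some k) \<longleftrightarrow> u = v"
| "corona G H (u, Some h) (v, None) \<longleftrightarrow> u = v"
| "corona G H (u, Some h) (v, Some k) \<longleftrightarrow> u = v \<and> H h k"

definition adjacency_matrix :: "'v::finite graph \<Rightarrow> complex^'v^'v" where
  "adjacency_matrix G = (\<chi> u v. if G u v then 1 else 0)"

definition matrix_exp :: "complex^'v^'v \<Rightarrow> complex^'v^('v::finite)" where
  "matrix_exp M = (\<Sum>k. (1 / fact k) *\<^sub>R (((**) M ^^ k) (mat 1)))"

definition transition_matrix :: "'v::finite graph \<Rightarrow> real \<Rightarrow> complex^'v^'v" where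
  "transition_matrix X \<tau> = matrix_exp (\<chi> u v. - \<i> * of_real \<tau> * adjacency_matrix X $ u $ v)"

definition pretty_good_state_transfer :: "'v::finite graph \<Rightarrow> 'v \<Rightarrow> 'v \<Rightarrow> bool" where
  "pretty_good_state_transfer X a b \<longleftrightarrow>
    (\<forall>\<epsilon>>0. \<exists>(\<tau>::real) (\<gamma>::complex). norm \<gamma> = 1 \<and>
      norm (transition_matrix X \<tau> *v axis a 1 - \<gamma> *s axis b 1) < \<epsilon>)"

lemma symp_complete_graph: "symp complete_graph"
  by (auto simp: symp_def complete_graph_def)

lemma symp_edgeless_graph: "symp edgeless_graph"
  by (auto simp: symp_def edgeless_graph_def)

lemma symp_add_loops: "symp G \<Longrightarrow> symp (add_loops G)"
  by (auto simp: symp_def add_loops_def)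

lemma symp_corona:
  assumes "symp G" "symp H"
  shows "symp (corona G H)"
proof (rule sympI)
  fix x y assume "corona G H x y"
  then show "corona G H y x"
    using assms by (cases x; cases y; cases "snd x"; cases "snd y") (auto simp: symp_def)
qed

lemma adjacency_matrix_looped_complete_graph:
  "adjacency_matrix (add_loops complete_graph) = (\<chi> u v. 1)"
  by (simp add: adjacency_matrix_def add_loops_def complete_graph_def vec_eq_iff)

text \<open>Entrywise form of
  \<open>A(G \<circ> H) = A(G) \<otimes> e\<^sub>0 e\<^sub>0\<^sup>T + I \<otimes> B\<close>, where \<open>B\<close> is the adjacency matrix of the cone over \<open>H\<close>
  with apex \<open>0\<close>.\<close>

lemma adjacency_matrix_corona:
  "adjacency_matrix (corona G H) $ (u, x) $ (v, y) =
    adjacency_matrix G $ u $ v * (if x = None \<and> y = None then 1 else 0)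
    + mat 1 $ u $ v *
      (case (x, y) of (None, None) \<Rightarrow> 0 | (Some h, Some k) \<Rightarrow> adjacency_matrix H $ h $ k | _ \<Rightarrow> 1)"
  by (cases x; cases y) (auto simp: adjacency_matrix_def mat_def)

lemma norm_matrix_power_entry_le:
  fixes M :: "complex^'v^('v::finite)"
  assumes "\<And>i j. norm (M $ i $ j) \<le> c"
  shows "norm (((**) M ^^ k) (mat 1) $ i $ j) \<le> (real CARD('v) * c) ^ k"
proof (induction k arbitrary: i j)
  case 0
  then show ?case by (simp add: mat_def)
next
  case (Suc k)
  let ?P = "((**) M ^^ k) (mat 1)"
  have c: "0 \<le> c"
    using assms norm_ge_zero order_trans by blast
  have "norm ((M ** ?P) $ i $ j) \<le> (\<Sum>l\<in>UNIV. norm (M $ i $ l * ?P $ l $ j))"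
    by (simp add: matrix_matrix_mult_def norm_sum)
  also have "\<dots> \<le> (\<Sum>l\<in>(UNIV::'v set). c * (real CARD('v) * c) ^ k)"
    by (intro sum_mono) (auto simp: norm_mult c intro!: mult_mono assms Suc.IH)
  finally show ?case
    by (simp add: algebra_simps)
qed

lemma summable_matrix_exp:
  fixes M :: "complex^'v^('v::finite)"
  shows "summable (\<lambda>k. (1 / fact k) *\<^sub>R (((**) M ^^ k) (mat 1)))"
proof -
  define c where "c = (\<Sum>i\<in>UNIV. \<Sum>j\<in>UNIV. norm (M $ i $ j))"
  let ?N = "real CARD('v)"
  let ?P = "\<lambda>k. ((**) M ^^ k) (mat 1)"
  have c: "norm (M $ i $ j) \<le> c" for i j
  proof -
    have "norm (M $ i $ j) \<le> (\<Sum>j\<in>UNIV. norm (M $ i $ j))"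
      by (rule member_le_sum) auto
    also have "\<dots> \<le> c"
      unfolding c_def by (rule member_le_sum[where f = "\<lambda>i. \<Sum>j\<in>UNIV. norm (M $ i $ j)"]) (auto intro: sum_nonneg)
    finally show ?thesis .
  qed
  have P: "norm (?P k) \<le> ?N * (?N * (?N * c) ^ k)" for k
  proof -
    have "norm (?P k) \<le> (\<Sum>i\<in>UNIV. norm (?P k $ i))"
      unfolding norm_vec_def[of "?P k"] by (rule L2_set_le_sum) auto
    also have "\<dots> \<le> (\<Sum>i\<in>UNIV. \<Sum>j\<in>UNIV. norm (?P k $ i $ j))"
      by (rule sum_mono) (unfold norm_vec_def[of "?P k $ _"], rule L2_set_le_sum, auto)
    also have "\<dots> \<le> (\<Sum>i\<in>(UNIV::'v set). \<Sum>j\<in>(UNIV::'v set). (?N * c) ^ k)"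
      by (intro sum_mono norm_matrix_power_entry_le c)
    finally show ?thesis by simp
  qed
  have "summable (\<lambda>k. ?N * ?N * ((1 / fact k) * (?N * c) ^ k))"
    using summable_exp[of "?N * c"] by (intro summable_mult) (simp add: field_simps)
  then show ?thesis
  proof (rule summable_comparison_test')
    fix k :: nat
    show "norm ((1 / fact k) *\<^sub>R ?P k) \<le> ?N * ?N * ((1 / fact k) * (?N * c) ^ k)"
      using P[of k] by (simp add: divide_simps mult_ac)
  qed
qed

end

theory Submission imports Defs begin

text \<open>Let \<open>J\<close> be the all-ones matrix of order \<open>n\<close> and \<open>A\<close> the adjacency matrix of the corona. If
  \<open>J g = \<mu> g\<close> and \<open>\<kappa>\<^sup>2 = \<mu> \<kappa> + 2\<close>, then the vector with values \<open>\<kappa> g(u)\<close> at \<open>(u, 0)\<close> and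
  \<open>g(u)\<close> at \<open>(u, 1)\<close> and \<open>(u, 2)\<close> is mapped by \<open>A\<close> to its multiple by \<open>\<kappa>\<close>. Since \<open>J\<close> has the
  eigenvalues \<open>n\<close> and \<open>0\<close>, this gives the eigenvalues \<open>(n \<plusminus> \<surd>(n\<^sup>2 + 8)) / 2\<close> and \<open>\<plusminus>\<surd>2\<close> of \<open>A\<close>.
  Let \<open>e\<^sub>1\<close> and \<open>e\<^sub>2\<close> be the basis vectors of \<open>(v, 1)\<close> and \<open>(v, 2)\<close>; then \<open>e\<^sub>1 + e\<^sub>2\<close> is a sum of
  four such eigenvectors, one for each of these eigenvalues, and \<open>e\<^sub>1 - e\<^sub>2\<close> lies in the kernel of
  \<open>A\<close>. With the phase \<open>-1\<close>, pretty good transfer from \<open>(v, 1)\<close> to \<open>(v, 2)\<close> therefore follows once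
  there are times \<open>\<tau>\<close> at which \<open>exp (- i \<tau> \<kappa>)\<close> is arbitrarily close to \<open>-1\<close> for all four
  eigenvalues \<open>\<kappa>\<close> (\<open>pretty_good_state_transferI\<close>).

  Such times \<open>\<tau>\<close> are supplied by Kronecker's theorem (\<open>eigenvalue_approximation\<close>). For
  \<open>n \<ge> 2\<close>, \<open>n\<^sup>2 + 8\<close> is not a square; this fails for \<open>n = 1\<close>. If \<open>2 (n\<^sup>2 + 8)\<close> is not a square
  either, then \<open>1\<close>, \<open>\<surd>2\<close> and \<open>\<surd>(n\<^sup>2 + 8)\<close> are linearly independent over the rationals, hence so are
  \<open>\<surd>2\<close> and \<open>(n \<plusminus> \<surd>(n\<^sup>2 + 8)) / 2\<close>. If \<open>2 (n\<^sup>2 + 8)\<close> is a square, then \<open>n = 4 c\<close> and the last two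
  eigenvalues are \<open>2 c \<plusminus> b \<surd>2\<close> with \<open>b\<close> odd, so that it suffices to control \<open>\<tau>\<surd>2\<close> and \<open>\<tau>\<close>.\<close>

section \<open>Pretty good state transfer from an eigenvector decomposition\<close>

lemma matrix_power_eigenvector:
  fixes M :: "complex^'v^('v::finite)"
  assumes "M *v w = \<mu> *s w"
  shows "((**) M ^^ k) (mat 1) *v w = \<mu> ^ k *s w"
proof (induction k)
  case (Suc k)
  then show ?case
    by (simp add: assms vector_scalar_commute vector_smult_assoc mult.commute
        flip: matrix_vector_mul_assoc)
qed (simp add: matrix_vector_mul_lid)

lemma matrix_exp_eigenvector:
  fixes M :: "complex^'v^('v::finite)"
  assumes "M *v w = \<mu> *s w"
  shows "matrix_exp M *v w = exp \<mu> *s w"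
proof -
  have lin: "linear (\<lambda>A :: complex^'v^'v. A *v w)"
    by (rule linearI)
      (simp_all add: vec_eq_iff matrix_vector_mult_def scaleR_sum_right sum.distrib distrib_right)
  then have "bounded_linear (\<lambda>A :: complex^'v^'v. A *v w)"
    by (simp add: linear_conv_bounded_linear)
  from bounded_linear.sums[OF this summable_sums[OF summable_matrix_exp[of M]]]
  have "(\<lambda>k. ((1 / fact k) *\<^sub>R ((**) M ^^ k) (mat 1)) *v w) sums (matrix_exp M *v w)"
    unfolding matrix_exp_def .
  then have exp_M: "(\<lambda>k. (\<mu> ^ k /\<^sub>R fact k) *s w) sums (matrix_exp M *v w)"
  proof (rule sums_cong[THEN iffD1, rotated])
    show "((1 / fact k) *\<^sub>R ((**) M ^^ k) (mat 1)) *v w = (\<mu> ^ k /\<^sub>R fact k) *s w" for k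
      by (simp add: linear_scale[OF lin] matrix_power_eigenvector[OF assms] divide_inverse vec_eq_iff)
  qed
  have "linear (\<lambda>z :: complex. z *s w)"
    by (rule linearI) (simp_all add: vec_eq_iff algebra_simps)
  then have "bounded_linear (\<lambda>z :: complex. z *s w)"
    by (simp add: linear_conv_bounded_linear)
  from bounded_linear.sums[OF this exp_converges[of \<mu>]]
  show ?thesis
    by (rule sums_unique2[OF exp_M])
qed

lemma transition_matrix_eigenvector:
  assumes "adjacency_matrix X *v w = of_real \<kappa> *s w"
  shows "transition_matrix X \<tau> *v w = exp (- (\<i> * of_real (\<tau> * \<kappa>))) *s w"
proof -
  let ?M = "\<chi> u v. - \<i> * of_real \<tau> * adjacency_matrix X $ u $ v"
  have "?M *v w = (- \<i> * of_real \<tau>) *s (adjacency_matrix X *v w)"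
    by (simp add: vec_eq_iff matrix_vector_mult_def sum_distrib_left mult_ac flip: sum_negf)
  also have "\<dots> = (- (\<i> * of_real (\<tau> * \<kappa>))) *s w"
    by (simp add: assms vec_eq_iff mult_ac)
  finally show ?thesis
    unfolding transition_matrix_def by (rule matrix_exp_eigenvector)
qed

lemma norm_exp_plus_1_le:
  fixes s :: real and h :: int
  shows "norm (exp (- (\<i> * of_real (2 * pi * s))) + 1) \<le> 2 * pi * \<bar>s - of_int h - 1/2\<bar>"
proof -
  define y where "y = s - of_int h - 1/2"
  have "- (\<i> * of_real (2 * pi * s)) =
      \<i> * of_real (- (2 * pi * y)) - \<i> * of_real pi - of_int h * (2 * of_real pi * \<i>)"
    by (simp add: y_def algebra_simps)
  moreover have "exp (of_int h * (2 * of_real pi * \<i>)) = 1"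
    by (simp add: exp_eq_1)
  ultimately have "exp (- (\<i> * of_real (2 * pi * s))) =
      exp (\<i> * of_real (- (2 * pi * y)) - \<i> * of_real pi)"
    by (simp add: exp_diff)
  also have "\<dots> = - exp (\<i> * of_real (- (2 * pi * y)))"
    by (simp add: exp_diff mult.commute)
  finally have "norm (exp (- (\<i> * of_real (2 * pi * s))) + 1) =
      norm (exp (\<i> * of_real (- (2 * pi * y))) - 1)"
    by (metis add.commute minus_diff_eq norm_minus_cancel uminus_add_conv_diff)
  also have "\<dots> = 2 * \<bar>sin (- (2 * pi * y) / 2)\<bar>"
    by (rule dist_exp_i_1)
  also have "\<dots> \<le> 2 * \<bar>- (2 * pi * y) / 2\<bar>"
    by (intro mult_left_mono abs_sin_x_le_abs_x) auto
  finally show ?thesis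
    by (simp add: y_def abs_mult)
qed

text \<open>With phase \<open>\<gamma> = -1\<close>, transfer along the decomposition below amounts to finding times at which
  every \<open>exp (- i \<tau> \<theta>)\<close> is close to \<open>-1\<close>. In the last assumption time is measured in units of
  \<open>2 \<pi>\<close>, so that \<open>t \<theta>\<close> has to be close to one half modulo one.\<close>

lemma pretty_good_state_transferI:
  fixes X :: "'v::finite graph" and \<theta> :: "'i \<Rightarrow> real"
  assumes a: "axis a 1 = w\<^sub>0 + (\<Sum>i\<in>I. w i)"
    and b: "axis b 1 = (\<Sum>i\<in>I. w i) - w\<^sub>0"
    and kernel: "adjacency_matrix X *v w\<^sub>0 = 0"
    and eigen: "\<And>i. i \<in> I \<Longrightarrow> adjacency_matrix X *v w i = of_real (\<theta> i) *s w i"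
    and approx: "\<And>\<delta>. \<delta> > 0 \<Longrightarrow> \<exists>t. \<forall>i\<in>I. \<exists>h::int. \<bar>t * \<theta> i - of_int h - 1/2\<bar> < \<delta>"
  shows "pretty_good_state_transfer X a b"
  unfolding pretty_good_state_transfer_def
proof (intro allI impI)
  fix \<epsilon> :: real
  assume "\<epsilon> > 0"
  define C where "C = (\<Sum>i\<in>I. norm (w i))"
  define \<delta> where "\<delta> = \<epsilon> / (2 * pi * (C + 1))"
  have "C \<ge> 0"
    by (simp add: C_def sum_nonneg)
  with \<open>\<epsilon> > 0\<close> have "\<delta> > 0"
    by (simp add: \<delta>_def)
  from approx[OF this] obtain t where
    t: "\<And>i. i \<in> I \<Longrightarrow> \<exists>h::int. \<bar>t * \<theta> i - of_int h - 1/2\<bar> < \<delta>"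
    by blast
  define z where "z i = exp (- (\<i> * of_real (2 * pi * t * \<theta> i))) + 1" for i
  have z: "norm (z i) \<le> 2 * pi * \<delta>" if i: "i \<in> I" for i
  proof -
    from t[OF i] obtain h :: int where h: "\<bar>t * \<theta> i - of_int h - 1/2\<bar> < \<delta>"
      by blast
    have "norm (z i) \<le> 2 * pi * \<bar>t * \<theta> i - of_int h - 1/2\<bar>"
      using norm_exp_plus_1_le[of "t * \<theta> i" h] by (simp add: z_def mult_ac)
    also have "\<dots> \<le> 2 * pi * \<delta>"
      using h by (intro mult_left_mono) auto
    finally show ?thesis .
  qed
  let ?U = "transition_matrix X (2 * pi * t)"
  have "adjacency_matrix X *v w\<^sub>0 = of_real 0 *s w\<^sub>0"
    by (simp add: kernel)
  from transition_matrix_eigenvector[OF this] have "?U *v w\<^sub>0 = w\<^sub>0"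
    by simp
  then have "?U *v axis a 1 = w\<^sub>0 + (\<Sum>i\<in>I. ?U *v w i)"
    by (simp add: a matrix_vector_right_distrib linear_sum[OF matrix_vector_mul_linear])
  also have "(\<Sum>i\<in>I. ?U *v w i) = (\<Sum>i\<in>I. z i *s w i - w i)"
    by (intro sum.cong refl)
      (simp add: transition_matrix_eigenvector[OF eigen] z_def vec_eq_iff algebra_simps)
  finally have U: "?U *v axis a 1 - (-1) *s axis b 1 = (\<Sum>i\<in>I. z i *s w i)"
    by (simp add: b sum_subtractf)
  have "norm (\<Sum>i\<in>I. z i *s w i) \<le> (\<Sum>i\<in>I. 2 * pi * \<delta> * norm (w i))"
  proof (rule sum_norm_le)
    fix i
    assume "i \<in> I"
    have "norm (z i *s w i) = norm (z i) * norm (w i)"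
      by (simp add: norm_vec_def norm_mult L2_set_right_distrib)
    then show "norm (z i *s w i) \<le> 2 * pi * \<delta> * norm (w i)"
      using z[OF \<open>i \<in> I\<close>] by (simp add: mult_right_mono)
  qed
  moreover have "(\<Sum>i\<in>I. 2 * pi * \<delta> * norm (w i)) = \<epsilon> * (C / (C + 1))"
    using \<open>C \<ge> 0\<close> by (simp only: \<delta>_def sum_distrib_left[symmetric] C_def[symmetric]) simp
  moreover have "\<epsilon> * (C / (C + 1)) < \<epsilon>"
    using \<open>C \<ge> 0\<close> \<open>\<epsilon> > 0\<close> by (simp add: field_simps)
  ultimately have "norm (?U *v axis a 1 - (-1) *s axis b 1) < \<epsilon>"
    unfolding U
    by linarith
  then show "\<exists>\<tau> \<gamma>. norm \<gamma> = 1 \<and>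
      norm (transition_matrix X \<tau> *v axis a 1 - \<gamma> *s axis b 1) < \<epsilon>"
    by (intro exI[of _ "2 * pi * t"] exI[of _ "-1"]) simp
qed


section \<open>Eigenvectors of a corona with an edgeless graph\<close>

text \<open>The vector with value \<open>\<kappa> g(u)\<close> at the base vertex \<open>(u, 0)\<close> and \<open>g(u)\<close> at every vertex
  \<open>(u, h)\<close> of the copy of the second graph at \<open>u\<close>.\<close>

definition corona_vector :: "real \<Rightarrow> ('a \<Rightarrow> complex) \<Rightarrow> complex^('a::finite \<times> 'b::finite option)" where
  "corona_vector \<kappa> g = (\<chi> x. (if snd x = None then of_real \<kappa> else 1) * g (fst x))"

lemma sum_Times_option:
  fixes f :: "'a::finite \<times> 'b::finite option \<Rightarrow> complex"
  shows "sum f UNIV = (\<Sum>u\<in>UNIV. f (u, None) + (\<Sum>h\<in>UNIV. f (u, Some h)))"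
proof -
  have "sum f UNIV = (\<Sum>u\<in>UNIV. \<Sum>x\<in>UNIV. f (u, x))"
    by (simp add: sum.cartesian_product)
  then show ?thesis
    by (simp add: UNIV_option_conv sum.reindex)
qed

lemma corona_eigenvector:
  fixes G :: "'a::finite graph"
  assumes g: "\<And>u. (\<Sum>v\<in>UNIV. if G u v then g v else 0) = of_real \<mu> * g u"
    and \<kappa>: "\<kappa>\<^sup>2 = \<mu> * \<kappa> + CARD('b::finite)"
  shows "adjacency_matrix (corona G (edgeless_graph :: 'b graph)) *v corona_vector \<kappa> g =
    of_real \<kappa> *s corona_vector \<kappa> g" (is "?A *v ?w = _")
proof -
  have "(?A *v ?w) $ (u, x) = (of_real \<kappa> *s ?w) $ (u, x)" for u x
  proof (cases x)
    case None
    have "(?A *v ?w) $ (u, x) =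
        (\<Sum>v\<in>UNIV. of_real \<kappa> * (if G u v then g v else 0) + of_nat CARD('b) * (if u = v then g v else 0))"
      unfolding matrix_vector_mult_def vec_lambda_beta sum_Times_option
      by (intro sum.cong refl) (simp add: None corona_vector_def adjacency_matrix_def)
    also have "\<dots> = of_real \<kappa> * (of_real \<mu> * g u) + of_nat CARD('b) * g u"
      by (simp add: sum.distrib g flip: sum_distrib_left)
    also have "\<dots> = of_real (\<mu> * \<kappa> + CARD('b)) * g u"
      by (simp add: algebra_simps)
    also have "\<dots> = of_real (\<kappa>\<^sup>2) * g u"
      by (simp only: \<kappa>)
    finally show ?thesis
      by (simp add: None corona_vector_def power2_eq_square)
  next
    case (Some h)
    have "(?A *v ?w) $ (u, x) = (\<Sum>v\<in>UNIV. if u = v then of_real \<kappa> * g v else 0)"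
      unfolding matrix_vector_mult_def vec_lambda_beta sum_Times_option
      by (intro sum.cong refl)
        (simp add: Some corona_vector_def adjacency_matrix_def edgeless_graph_def)
    then show ?thesis
      by (simp add: Some corona_vector_def)
  qed
  then show ?thesis
    by (simp add: vec_eq_iff)
qed

lemma corona_kernel:
  fixes G :: "'a::finite graph" and h k :: "'b::finite"
  shows "adjacency_matrix (corona G edgeless_graph) *v
    (axis (v, Some h) 1 - axis (v, Some k) 1) = 0"
proof -
  let ?A = "adjacency_matrix (corona G (edgeless_graph :: 'b graph))"
  have column: "(?A *v axis j 1) $ i = ?A $ i $ j" for i j
    unfolding matrix_vector_mult_def vec_lambda_beta axis_def
    by (subst sum.remove[of _ j]) (auto intro!: sum.neutral)
  have "?A $ (u, x) $ (v, Some h) = ?A $ (u, x) $ (v, Some k)" for u x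
    by (cases x) (simp_all add: adjacency_matrix_def edgeless_graph_def)
  then show ?thesis
    by (simp add: matrix_vector_mult_diff_distrib column vec_eq_iff)
qed

text \<open>The vector that equals \<open>g\<close> on the copies of the second graph and vanishes on the base,
  written in terms of two eigenvectors as produced by the previous construction.\<close>

lemma corona_vector_split:
  assumes "\<kappa> \<noteq> \<mu>"
  shows "corona_vector \<kappa> (\<lambda>u. of_real (\<mu> / (\<mu> - \<kappa>)) * g u) +
    corona_vector \<mu> (\<lambda>u. of_real (\<kappa> / (\<kappa> - \<mu>)) * g u) = corona_vector 0 g"
proof -
  have "\<mu> / (\<mu> - \<kappa>) + \<kappa> / (\<kappa> - \<mu>) = 1" "\<kappa> * (\<mu> / (\<mu> - \<kappa>)) + \<mu> * (\<kappa> / (\<kappa> - \<mu>)) = 0"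
    using assms by (simp_all add: divide_simps) (simp_all add: algebra_simps)
  then have "of_real (\<mu> / (\<mu> - \<kappa>)) * z + of_real (\<kappa> / (\<kappa> - \<mu>)) * z = z"
    "of_real \<kappa> * (of_real (\<mu> / (\<mu> - \<kappa>)) * z) + of_real \<mu> * (of_real (\<kappa> / (\<kappa> - \<mu>)) * z) = 0"
    for z :: complex
    by (metis (no_types) distrib_right mult.assoc mult_1 mult_zero_left of_real_0 of_real_1
        of_real_add of_real_mult)+
  then show ?thesis
    by (simp add: corona_vector_def vec_eq_iff del: of_real_divide)
qed


section \<open>Simultaneous approximation of the eigenvalues\<close>

text \<open>Kronecker's theorem with independence stated for the family \<open>\<theta>\<close> instead of its range, which
  includes the distinctness of the \<open>\<theta> i\<close>.\<close>

lemma Kronecker_int_independent: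
  fixes \<theta> \<alpha> :: "nat \<Rightarrow> real"
  assumes indep: "\<forall>c :: nat \<Rightarrow> int. (\<Sum>i<n. of_int (c i) * \<theta> i) = 0 \<longrightarrow> (\<forall>i<n. c i = 0)"
    and "\<epsilon> > 0"
  shows "\<exists>t (h :: nat \<Rightarrow> int). \<forall>i<n. \<bar>t * \<theta> i - of_int (h i) - \<alpha> i\<bar> < \<epsilon>"
proof -
  interpret Modules.module "\<lambda>r. (*) (real_of_int r)"
    by (simp add: Modules.module.intro distrib_left mult.commute)
  \<comment> \<open>If \<open>\<theta> i = \<theta> j\<close>, then the coefficients \<open>1\<close> at \<open>i\<close> and \<open>-1\<close> at \<open>j\<close> give a relation.\<close>
  have inj: "inj_on \<theta> {..<n}"
  proof (rule inj_onI, rule ccontr)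
    fix i j
    assume ij: "i \<in> {..<n}" "j \<in> {..<n}" "\<theta> i = \<theta> j" "i \<noteq> j"
    let ?c = "\<lambda>k. (if k = i then 1 else 0) - (if k = j then 1 else (0::int))"
    have "(\<Sum>k<n. of_int (?c k) * \<theta> k) =
        (\<Sum>k<n. (if k = i then \<theta> k else 0) - (if k = j then \<theta> k else 0))"
      by (intro sum.cong) auto
    also have "\<dots> = 0"
      using ij by (simp add: sum_subtractf)
    finally have "?c i = 0"
      using indep[rule_format, of ?c i] ij by simp
    with ij show False
      by simp
  qed
  have "independent (\<theta> ` {..<n})"
  proof
    assume "dependent (\<theta> ` {..<n})"
    then obtain u where u: "\<exists>x\<in>\<theta> ` {..<n}. u x \<noteq> 0"
        "(\<Sum>x\<in>\<theta> ` {..<n}. real_of_int (u x) * x) = 0"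
      by (auto simp: dependent_finite)
    have "(\<Sum>i<n. real_of_int (u (\<theta> i)) * \<theta> i) = 0"
      using u(2) by (simp add: sum.reindex[OF inj])
    with indep[rule_format, of "\<lambda>i. u (\<theta> i)"] u(1) show False
      by auto
  qed
  from Kronecker_thm_1[OF this inj \<open>\<epsilon> > 0\<close>, of \<alpha>] show ?thesis
    by metis
qed

lemma int_square_quotient:
  fixes a c d :: int
  assumes "a\<^sup>2 = c\<^sup>2 * d" "c \<noteq> 0"
  shows "\<exists>k. d = k\<^sup>2"
proof -
  have "c\<^sup>2 dvd a\<^sup>2"
    using assms by simp
  then have "c dvd a"
    by simp
  then obtain k where "a = c * k"
    by blast
  with assms have "d = k\<^sup>2"
    by (simp add: power_mult_distrib)
  then show ?thesis
    by blast
qed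

lemma two_not_square: "(2::int) \<noteq> k\<^sup>2"
proof
  assume k: "2 = k\<^sup>2"
  have "\<bar>k\<bar> \<le> 1 \<or> 2 \<le> \<bar>k\<bar>"
    by linarith
  then show False
  proof
    assume "\<bar>k\<bar> \<le> 1"
    then have "\<bar>k\<bar>\<^sup>2 \<le> 1\<^sup>2"
      by (intro power_mono) auto
    with k show False by simp
  next
    assume "2 \<le> \<bar>k\<bar>"
    then have "2\<^sup>2 \<le> \<bar>k\<bar>\<^sup>2"
      by (intro power_mono) auto
    with k show False by simp
  qed
qed

lemma sqrt2_int_independent:
  fixes a b :: int
  assumes "of_int a + of_int b * sqrt 2 = 0"
  shows "a = 0 \<and> b = 0"
proof -
  have "of_int a = - (of_int b * sqrt 2)"
    using assms by linarith
  then have "(of_int a)\<^sup>2 = (of_int b * sqrt 2)\<^sup>2"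
    by simp
  then have "real_of_int (a\<^sup>2) = of_int (b\<^sup>2 * 2)"
    by (simp add: power_mult_distrib)
  then have "a\<^sup>2 = b\<^sup>2 * 2"
    by (simp only: of_int_eq_iff)
  then have "b = 0"
    using int_square_quotient two_not_square by blast
  with assms show ?thesis
    by simp
qed

lemma sqrt2_sqrt_int_independent:
  fixes a b c d :: int
  assumes "d \<ge> 0" "\<And>k. d \<noteq> k\<^sup>2" "\<And>k. 2 * d \<noteq> k\<^sup>2"
    and eq: "of_int a + of_int b * sqrt 2 + of_int c * sqrt (of_int d) = 0"
  shows "a = 0 \<and> b = 0 \<and> c = 0"
proof -
  have "of_int a + of_int b * sqrt 2 = - (of_int c * sqrt (of_int d))"
    using eq by linarith
  then have "(of_int a + of_int b * sqrt 2)\<^sup>2 = (of_int c * sqrt (of_int d))\<^sup>2"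
    by simp
  then have sq: "of_int (a\<^sup>2 + 2 * b\<^sup>2 - c\<^sup>2 * d) + of_int (2 * a * b) * sqrt 2 = 0"
    using \<open>d \<ge> 0\<close> by (simp add: power2_sum power_mult_distrib algebra_simps)
  from sqrt2_int_independent[OF sq] have ab: "a = 0 \<or> b = 0" and d: "a\<^sup>2 + 2 * b\<^sup>2 = c\<^sup>2 * d"
    by auto
  have "c = 0"
  proof (rule ccontr)
    assume "c \<noteq> 0"
    from ab show False
    proof
      assume "a = 0"
      with d have "(2 * b)\<^sup>2 = c\<^sup>2 * (2 * d)"
        by (simp add: power_mult_distrib)
      with int_square_quotient \<open>c \<noteq> 0\<close> assms(3) show False
        by blast
    next
      assume "b = 0"
      with d have "a\<^sup>2 = c\<^sup>2 * d"
        by simp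
      with int_square_quotient \<open>c \<noteq> 0\<close> assms(2) show False
        by blast
    qed
  qed
  with eq sqrt2_int_independent show ?thesis
    by simp
qed

lemma square_plus_8_not_square:
  fixes n k :: int
  assumes "n \<ge> 2"
  shows "n\<^sup>2 + 8 \<noteq> k\<^sup>2"
proof
  assume k: "n\<^sup>2 + 8 = k\<^sup>2"
  have "n\<^sup>2 < \<bar>k\<bar>\<^sup>2"
    using k by simp
  then have "n < \<bar>k\<bar>"
    by (rule power_less_imp_less_base) simp
  then consider "\<bar>k\<bar> = n + 1" | "n + 2 \<le> \<bar>k\<bar>"
    by linarith
  then show False
  proof cases
    case 1
    then have "n\<^sup>2 + 8 = (n + 1)\<^sup>2"
      using k by (metis power2_abs)
    then have "2 * n = 7"
      by (simp add: power2_sum)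
    then show False
      by presburger
  next
    case 2
    then have "(n + 2)\<^sup>2 \<le> \<bar>k\<bar>\<^sup>2"
      using assms by (intro power_mono) auto
    with k assms show False
      by (simp add: power2_sum)
  qed
qed

lemma even_square_times_2:
  fixes a m :: int
  assumes "a\<^sup>2 = 2 * m"
  obtains b where "a = 2 * b" "m = 2 * b\<^sup>2"
proof -
  have "even (a\<^sup>2)"
    using assms by simp
  then obtain b where "a = 2 * b"
    by auto
  with assms that show thesis
    by (simp add: power_mult_distrib)
qed

text \<open>The exceptional values of \<open>n\<close>, such as \<open>n = 8\<close>, come from the Pell equation
  \<open>b\<^sup>2 = 2 c\<^sup>2 + 1\<close>; what matters below is that \<open>b\<close> is odd.\<close>

lemma twice_square_plus_8_square:
  fixes n k :: int
  assumes "2 * (n\<^sup>2 + 8) = k\<^sup>2"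
  obtains b c where "n = 4 * c" "b\<^sup>2 = 2 * c\<^sup>2 + 1"
proof -
  obtain k' where k': "n\<^sup>2 + 8 = 2 * k'\<^sup>2"
    using even_square_times_2[of k "n\<^sup>2 + 8"] assms by metis
  then have "n\<^sup>2 = 2 * (k'\<^sup>2 - 4)"
    by simp
  then obtain a where a: "n = 2 * a" "k'\<^sup>2 - 4 = 2 * a\<^sup>2"
    by (rule even_square_times_2)
  then have "k'\<^sup>2 = 2 * (a\<^sup>2 + 2)"
    by simp
  then obtain b where b: "a\<^sup>2 + 2 = 2 * b\<^sup>2"
    using even_square_times_2 by metis
  then have "a\<^sup>2 = 2 * (b\<^sup>2 - 1)"
    by simp
  then obtain c where "a = 2 * c" "b\<^sup>2 - 1 = 2 * c\<^sup>2"
    by (rule even_square_times_2)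
  with a that[of c b] show thesis
    by simp
qed

lemma eigenvalue_approximation:
  fixes n :: nat and \<delta> :: real
  assumes "n \<ge> 2" "\<delta> > 0"
  defines "s \<equiv> sqrt (real n ^ 2 + 8)"
  obtains t and h\<^sub>0 h\<^sub>1 h\<^sub>2 :: int where
    "\<bar>t * sqrt 2 - of_int h\<^sub>0 - 1/2\<bar> < \<delta>"
    "\<bar>t * ((real n + s) / 2) - of_int h\<^sub>1 - 1/2\<bar> < \<delta>"
    "\<bar>t * ((real n - s) / 2) - of_int h\<^sub>2 - 1/2\<bar> < \<delta>"
proof (cases "\<exists>k. 2 * ((int n)\<^sup>2 + 8) = k\<^sup>2")
  case False
  let ?\<theta> = "\<lambda>i::nat. if i = 0 then sqrt 2 else if i = 1 then (real n + s) / 2 else (real n - s) / 2"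
  have indep: "\<forall>c :: nat \<Rightarrow> int. (\<Sum>i<3. of_int (c i) * ?\<theta> i) = 0 \<longrightarrow> (\<forall>i<3. c i = 0)"
  proof (intro allI impI)
    fix c :: "nat \<Rightarrow> int" and i :: nat
    assume c: "(\<Sum>i<3. of_int (c i) * ?\<theta> i) = 0" and "i < 3"
    have "of_int (c 0) * sqrt 2 + of_int (c 1) * ((real n + s) / 2)
        + of_int (c 2) * ((real n - s) / 2) = 0"
      using c by (simp add: numeral_3_eq_3 numeral_2_eq_2)
    then have "of_int ((c 1 + c 2) * int n) + of_int (2 * c 0) * sqrt 2
        + of_int (c 1 - c 2) * sqrt (of_int ((int n)\<^sup>2 + 8)) = 0"
      by (simp add: s_def field_simps)
    then have "(c 1 + c 2) * int n = 0 \<and> 2 * c 0 = 0 \<and> c 1 - c 2 = 0"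
    proof (rule sqrt2_sqrt_int_independent[rotated 3])
      show "(int n)\<^sup>2 + 8 \<noteq> k\<^sup>2" for k
        using square_plus_8_not_square[of "int n" k] assms by simp
    qed (use False in auto)
    then have "c 0 = 0" "c 1 = 0" "c 2 = 0"
      using assms by auto
    with \<open>i < 3\<close> show "c i = 0"
      by (auto simp: numeral_3_eq_3 numeral_2_eq_2 less_Suc_eq)
  qed
  obtain t h where th: "\<And>i. i < 3 \<Longrightarrow> \<bar>t * ?\<theta> i - of_int (h i) - 1/2\<bar> < \<delta>"
    using Kronecker_int_independent[OF indep \<open>\<delta> > 0\<close>, of "\<lambda>_. 1/2"] by auto
  show thesis
    using that[of t "h 0" "h 1" "h 2"] th[of 0] th[of 1] th[of 2] by simp
next
  case True
  then obtain b c where n: "int n = 4 * c" and bc: "b\<^sup>2 = 2 * c\<^sup>2 + 1"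
    using twice_square_plus_8_square by metis
  \<comment> \<open>The absolute value is taken so that \<open>s = 2 d \<surd>2\<close>.\<close>
  define d where "d = \<bar>b\<bar>"
  have d: "d\<^sup>2 = 2 * c\<^sup>2 + 1" "d \<ge> 0"
    using bc by (simp_all add: d_def)
  have "odd (d\<^sup>2)"
    unfolding d by simp
  then obtain e where e: "d = 2 * e + 1"
    using oddE by auto
  have rn: "real n = 4 * of_int c"
    using arg_cong[OF n, of real_of_int] by simp
  have "(real_of_int d)\<^sup>2 = 2 * (of_int c)\<^sup>2 + 1"
    using arg_cong[OF d(1), of real_of_int] by simp
  then have "real n ^ 2 + 8 = (2 * of_int d * sqrt 2)\<^sup>2"
    by (simp add: rn power_mult_distrib)
  then have s: "s = 2 * of_int d * sqrt 2"
    using d(2) by (simp add: s_def)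
  \<comment> \<open>The eigenvalues are \<open>2 c \<plusminus> d \<surd>2\<close>. If \<open>t \<surd>2\<close> is within \<open>\<delta> / K\<close> of one half and \<open>t\<close> within
    \<open>\<delta> / K\<close> of zero modulo one, then \<open>t (2 c \<plusminus> d \<surd>2)\<close> is within \<open>(2 \<bar>c\<bar> + d) \<delta> / K < \<delta>\<close> of
    \<open>\<plusminus> d / 2\<close> modulo one, which is one half modulo one because \<open>d\<close> is odd.\<close>
  define K where "K = real_of_int d + 2 * \<bar>of_int c\<bar> + 1"
  have K: "K \<ge> 1"
    using d(2) by (simp add: K_def)
  let ?\<theta> = "\<lambda>i::nat. if i = 0 then sqrt 2 else 1"
  have indep: "\<forall>a :: nat \<Rightarrow> int. (\<Sum>i<2. of_int (a i) * ?\<theta> i) = 0 \<longrightarrow> (\<forall>i<2. a i = 0)"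
  proof (intro allI impI)
    fix a :: "nat \<Rightarrow> int" and i :: nat
    assume a: "(\<Sum>i<2. of_int (a i) * ?\<theta> i) = 0" and "i < 2"
    have "of_int (a 1) + of_int (a 0) * sqrt 2 = 0"
      using a by (simp add: numeral_2_eq_2)
    from sqrt2_int_independent[OF this] \<open>i < 2\<close> show "a i = 0"
      by (auto simp: numeral_2_eq_2 less_Suc_eq)
  qed
  have "\<delta> / K > 0"
    using K \<open>\<delta> > 0\<close> by simp
  obtain t h where th: "\<And>i. i < 2 \<Longrightarrow>
      \<bar>t * ?\<theta> i - of_int (h i) - (if i = 0 then 1/2 else 0)\<bar> < \<delta> / K"
    using Kronecker_int_independent[OF indep \<open>\<delta> / K > 0\<close>,
        of "\<lambda>i. if i = 0 then 1/2 else 0"] by auto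
  define x where "x = t * sqrt 2 - of_int (h 0) - 1/2"
  define y where "y = t - of_int (h 1)"
  have x: "\<bar>x\<bar> < \<delta> / K" and y: "\<bar>y\<bar> < \<delta> / K"
    using th[of 0] th[of 1] by (simp_all add: x_def y_def)
  have bound: "\<bar>of_int (2 * c) * y + r * of_int d * x\<bar> < \<delta>" if r: "\<bar>r\<bar> = 1" for r
  proof -
    have "\<bar>of_int (2 * c) * y + r * of_int d * x\<bar> \<le> \<bar>of_int (2 * c) * y\<bar> + \<bar>r * of_int d * x\<bar>"
      by (rule abs_triangle_ineq)
    also have "\<dots> = 2 * \<bar>of_int c\<bar> * \<bar>y\<bar> + of_int d * \<bar>x\<bar>"
      using d(2) r by (simp add: abs_mult)
    also have "\<dots> \<le> 2 * \<bar>of_int c\<bar> * (\<delta> / K) + of_int d * (\<delta> / K)"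
      using x y d(2) by (intro add_mono mult_left_mono) auto
    also have "\<dots> = (K - 1) * (\<delta> / K)"
      unfolding K_def by (simp only: algebra_simps)
    also have "\<dots> < \<delta>"
      using K \<open>\<delta> > 0\<close> by (simp add: field_simps)
    finally show ?thesis .
  qed
  show thesis
  proof (rule that)
    have "\<delta> / K \<le> \<delta>"
      using K \<open>\<delta> > 0\<close> by (simp add: field_simps)
    then show "\<bar>t * sqrt 2 - of_int (h 0) - 1/2\<bar> < \<delta>"
      using x by (simp add: x_def)
    have "t * ((real n + s) / 2) - of_int (2 * c * h 1 + d * h 0 + e) - 1/2 =
        of_int (2 * c) * y + 1 * of_int d * x"
      by (simp add: rn s x_def y_def e field_simps)
    then show "\<bar>t * ((real n + s) / 2) - of_int (2 * c * h 1 + d * h 0 + e) - 1/2\<bar> < \<delta>"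
      using bound[of 1] by simp
    have "t * ((real n - s) / 2) - of_int (2 * c * h 1 - d * h 0 - e - 1) - 1/2 =
        of_int (2 * c) * y + (-1) * of_int d * x"
      by (simp add: rn s x_def y_def e field_simps)
    then show "\<bar>t * ((real n - s) / 2) - of_int (2 * c * h 1 - d * h 0 - e - 1) - 1/2\<bar> < \<delta>"
      using bound[of "-1"] by simp
  qed
qed


section \<open>State transfer in the corona\<close>

text \<open>\<open>K\<^sub>n\<close> is the complete graph on the vertex type \<open>'n\<close> with \<open>n = CARD('n)\<close>; the two distinct
  elements \<open>1\<close> and \<open>2\<close> of the two-element numeral type are the vertices of the edgeless graph.\<close>

theorem theorem5p3:
  fixes v :: "'n::finite"
  assumes "CARD('n) \<ge> 2"
  shows "pretty_good_state_transfer
    (corona (add_loops complete_graph) (edgeless_graph :: 2 graph)) (v, Some 1) (v, Some 2)"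
proof -
  let ?n = "CARD('n)"
  let ?G = "add_loops complete_graph :: 'n graph"
  define s where "s = sqrt (real ?n ^ 2 + 8)"
  define p q where "p = (real ?n + s) / 2" and "q = (real ?n - s) / 2"
  have "s > 0"
    unfolding s_def by (simp add: add_nonneg_pos)
  have s2: "s\<^sup>2 = real ?n ^ 2 + 8"
    by (simp add: s_def)
  have p2: "p\<^sup>2 = real ?n * p + CARD(2)" and q2: "q\<^sup>2 = real ?n * q + CARD(2)"
    using s2 by (simp_all add: p_def q_def power2_eq_square field_simps)
  have "p \<noteq> q"
    using \<open>s > 0\<close> by (simp add: p_def q_def)
  have G: "?G u u'" for u u'
    by (simp add: add_loops_def complete_graph_def)
  \<comment> \<open>Half of the indicator function of \<open>v\<close> is split into the constant \<open>f\<close> and the function \<open>g\<close> of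
    sum zero; these belong to the eigenvalues \<open>n\<close> and \<open>0\<close> of the all-ones matrix.\<close>
  define f :: "'n \<Rightarrow> complex" where "f u = 1 / (2 * of_nat ?n)" for u
  define g :: "'n \<Rightarrow> complex" where "g u = (if u = v then 1/2 else 0) - f u" for u
  have f: "(\<Sum>u'\<in>UNIV. if ?G u u' then r * f u' else 0) = of_real (real ?n) * (r * f u)" for u r
    by (simp add: G f_def)
  have "(\<Sum>u\<in>UNIV. g u) = 0"
    by (simp add: g_def f_def sum_subtractf)
  then have g: "(\<Sum>u'\<in>UNIV. if ?G u u' then r * g u' else 0) = of_real 0 * (r * g u)" for u r
    by (simp add: G flip: sum_distrib_left)
  define \<theta> where "\<theta> i = [sqrt 2, - sqrt 2, p, q] ! i" for i
  define w :: "nat \<Rightarrow> complex^('n \<times> 2 option)" where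
    "w i = [corona_vector (sqrt 2) (\<lambda>u. of_real (- sqrt 2 / (- sqrt 2 - sqrt 2)) * g u),
       corona_vector (- sqrt 2) (\<lambda>u. of_real (sqrt 2 / (sqrt 2 - - sqrt 2)) * g u),
       corona_vector p (\<lambda>u. of_real (q / (q - p)) * f u),
       corona_vector q (\<lambda>u. of_real (p / (p - q)) * f u)] ! i" for i
  define w\<^sub>0 :: "complex^('n \<times> 2 option)" where
    "w\<^sub>0 = (1/2) *s (axis (v, Some 1) 1 - axis (v, Some 2) 1)"
  note nth = nth_Cons_0 nth_Cons_Suc One_nat_def numeral_2_eq_2 numeral_3_eq_3
  have four: "{..<4} = {0, 1, 2, 3 :: nat}"
    by auto
  have "(\<Sum>i<4. w i) = (w 0 + w 1) + (w 2 + w 3)"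
    by (simp add: four add.assoc)
  also have "w 0 + w 1 = corona_vector 0 g"
    by (simp only: w_def nth) (rule corona_vector_split, simp)
  also have "w 2 + w 3 = corona_vector 0 f"
    using corona_vector_split[OF \<open>p \<noteq> q\<close>, of f] by (simp add: w_def)
  also have "corona_vector 0 g + corona_vector 0 f =
      ((1/2) *s (axis (v, Some 1) 1 + axis (v, Some 2) 1) :: complex^('n \<times> 2 option))"
  proof -
    have "x = 1 \<or> x = 2" for x :: 2
      by (rule exhaust_2)
    then show ?thesis
      by (auto simp: vec_eq_iff corona_vector_def g_def axis_def)
  qed
  finally have sum_w: "(\<Sum>i<4. w i) = (1/2) *s (axis (v, Some 1) 1 + axis (v, Some 2) 1)" .
  show ?thesis
  proof (rule pretty_good_state_transferI[where w = w and \<theta> = \<theta> and I = "{..<4}" and w\<^sub>0 = w\<^sub>0])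
    show "axis (v, Some 1) 1 = w\<^sub>0 + (\<Sum>i<4. w i)"
      unfolding sum_w w\<^sub>0_def by (simp add: vec_eq_iff algebra_simps)
    show "axis (v, Some 2) 1 = (\<Sum>i<4. w i) - w\<^sub>0"
      unfolding sum_w w\<^sub>0_def by (simp add: vec_eq_iff algebra_simps)
    show "adjacency_matrix (corona ?G edgeless_graph) *v w\<^sub>0 = 0"
      unfolding w\<^sub>0_def vector_scalar_commute corona_kernel by simp
    show "adjacency_matrix (corona ?G edgeless_graph) *v w i = of_real (\<theta> i) *s w i"
      if "i \<in> {..<4}" for i
    proof -
      from that consider "i = 0" | "i = 1" | "i = 2" | "i = 3"
        by (auto simp: four)
      then show ?thesis
      proof cases
        case 1
        then show ?thesis
          by (simp only: w_def \<theta>_def nth)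
            (rule corona_eigenvector[OF g], simp)
      next
        case 2
        then show ?thesis
          by (simp only: w_def \<theta>_def nth)
            (rule corona_eigenvector[OF g], simp)
      next
        case 3
        then show ?thesis
          by (simp only: w_def \<theta>_def nth) (rule corona_eigenvector[OF f p2])
      next
        case 4
        then show ?thesis
          by (simp only: w_def \<theta>_def nth) (rule corona_eigenvector[OF f q2])
      qed
    qed
    show "\<exists>t. \<forall>i\<in>{..<4}. \<exists>h::int. \<bar>t * \<theta> i - of_int h - 1/2\<bar> < \<delta>" if "\<delta> > 0" for \<delta>
    proof -
      obtain t and h\<^sub>0 h\<^sub>1 h\<^sub>2 :: int where h:
        "\<bar>t * sqrt 2 - of_int h\<^sub>0 - 1/2\<bar> < \<delta>"
        "\<bar>t * p - of_int h\<^sub>1 - 1/2\<bar> < \<delta>"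
        "\<bar>t * q - of_int h\<^sub>2 - 1/2\<bar> < \<delta>"
        using eigenvalue_approximation[OF assms \<open>\<delta> > 0\<close>] unfolding p_def q_def s_def by metis
      moreover have "\<bar>t * (- sqrt 2) - of_int (- h\<^sub>0 - 1) - 1/2\<bar> < \<delta>"
        using h(1) by (simp add: abs_if split: if_splits)
      ultimately have "\<forall>i\<in>{0, 1, 2, 3}. \<exists>h::int. \<bar>t * \<theta> i - of_int h - 1/2\<bar> < \<delta>"
        unfolding \<theta>_def by (auto simp del: of_int_diff of_int_minus)
      then show ?thesis
        unfolding four by blast
    qed
  qed
qed

end
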